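(* Let $a=-\frac12$ and let $(R_n)_{n\geq 1}$ be the sequence of polynomials defined by $R_1(x)=x$ and, for $n\geq 1$, $R_{n+1}(x)=xR_n(x)-\frac{a}{n}(1-x^2)R_n'(x)$. Then for all $n\geq 1$, $$R_n(x)=\frac{1}{2^{n-1}}\sum_{k=0}^{\lfloor n/2\rfloor}\binom{n}{2k}x^{n-2k}=\left(\frac{x-1}{2}\right)^n+\left(\frac{x+1}{2}\right)^n.$$ *)

theory Defs
  imports Complex_Main "HOL-Computational_Algebra.Polynomial"
begin

abbreviation X :: "real poly" where
  "X \<equiv> monom 1 1"

end

theory Submission
  imports Defs
begin

text \<open>
  Put $u = (x-1)/2$ and $v = (x+1)/2$. Then $u + v = x$, $1 - x^2 = -4uv$ and $u' = v' = 1/2$, so for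
  $R_n = u^n + v^n$ the recurrence is the Newton identity
  $u^{n+1} + v^{n+1} = (u+v)(u^n+v^n) - uv(u^{n-1}+v^{n-1})$. The sum is the even part of
  the binomial expansion.
\<close>

lemma sum_atMost_even:
  fixes f :: "nat \<Rightarrow> 'a::comm_monoid_add"
  assumes "\<And>k. odd k \<Longrightarrow> f k = 0"
  shows "(\<Sum>k\<le>n. f k) = (\<Sum>k = 0..n div 2. f (2 * k))"
proof -
  have "(\<Sum>k = 0..n div 2. f (2 * k)) = sum f ((*) 2 ` {0..n div 2})"
    by (subst sum.reindex) (auto simp: inj_on_def)
  also have "\<dots> = (\<Sum>k\<le>n. f k)"
  proof (rule sum.mono_neutral_left)
    show "\<forall>i\<in>{..n} - (*) 2 ` {0..n div 2}. f i = 0"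
    proof
      fix i assume i: "i \<in> {..n} - (*) 2 ` {0..n div 2}"
      have "odd i"
      proof
        assume "even i"
        then obtain j where "i = 2 * j" by blast
        with i show False by auto
      qed
      with assms show "f i = 0" by blast
    qed
  qed auto
  finally show ?thesis ..
qed

text \<open>In the sum of the two binomial expansions \<open>y ^ k\<close> carries the factor (-1)^k
  + 1, so odd powers of \<open>y\<close> cancel and even ones double.\<close>

lemma binomial_add_power_minus_power:
  fixes x y :: "'a::comm_ring_1"
  shows "(x - y) ^ n + (x + y) ^ n =
    2 * (\<Sum>k = 0..n div 2. of_nat (n choose (2 * k)) * y ^ (2 * k) * x ^ (n - 2 * k))"
proof -
  let ?f = "\<lambda>k. of_nat (n choose k) * ((- y) ^ k + y ^ k) * x ^ (n - k)"
  \<comment> \<open>Commuting the summands makes \<open>binomial_ring\<close> put the exponent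
    \<open>k\<close> on \<open>y\<close> rather than on \<open>x\<close>.\<close>
  have "(x - y) ^ n + (x + y) ^ n = (- y + x) ^ n + (y + x) ^ n"
    by (simp add: add.commute)
  also have "\<dots> = (\<Sum>k\<le>n. ?f k)"
    by (simp only: binomial_ring sum.distrib[symmetric] distrib_left distrib_right)
  also have "\<dots> = (\<Sum>k = 0..n div 2. ?f (2 * k))"
    by (rule sum_atMost_even) simp
  also have "\<dots> = 2 * (\<Sum>k = 0..n div 2. of_nat (n choose (2 * k)) * y ^ (2 * k) * x ^ (n - 2 * k))"
    by (simp add: sum_distrib_left mult_ac flip: mult_2)
  finally show ?thesis .
qed

lemma X_eq: "X = [:0, 1:]"
  by (simp add: monom_altdef)

text \<open>Newton's identity reaches back two indices, but one-step induction suffices: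
  differentiating the closed form for \<open>m\<close> already produces the power sum of index
  \<open>m - 1\<close>.\<close>

lemma recurrence_power_sum:
  fixes R :: "nat \<Rightarrow> real poly"
  assumes "R 1 = X"
    and step: "\<And>m. m \<ge> 1 \<Longrightarrow>
      R (m + 1) = X * R m - smult (- 1 / 2 / real m) ((1 - X ^ 2) * pderiv (R m))"
    and "n \<ge> 1"
  shows "R n = smult (1 / 2) (X - 1) ^ n + smult (1 / 2) (X + 1) ^ n"
  using \<open>n \<ge> 1\<close>
proof (induction n rule: dec_induct)
  case base
  show ?case
    using \<open>R 1 = X\<close> unfolding X_eq by (simp add: one_pCons)
next
  case (step m)
  define u v :: "real poly" where "u = smult (1 / 2) (X - 1)" and "v = smult (1 / 2) (X + 1)"
  obtain k where m: "m = Suc k"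
    using step.hyps by (cases m) auto
  have X: "X = u + v" and "v - u = 1"
    unfolding u_def v_def X_eq by (simp_all add: one_pCons)
  \<comment> \<open>Writing 1 as \<open>(v - u) ^ 2\<close> makes the expression homogeneous in
    \<open>u\<close> and \<open>v\<close>.\<close>
  then have "1 - X ^ 2 = (v - u) ^ 2 - (u + v) ^ 2"
    by (simp only: power_one)
  also have "\<dots> = - 4 * (u * v)"
    by algebra
  finally have X2: "1 - X ^ 2 = - 4 * (u * v)" .
  have "pderiv u = [:1 / 2:]" "pderiv v = [:1 / 2:]"
    unfolding u_def v_def X_eq by (simp_all add: one_pCons pderiv_pCons)
  then have deriv: "pderiv (u ^ m + v ^ m) = smult (real m / 2) (u ^ k + v ^ k)"
    by (simp add: m pderiv_add pderiv_power_Suc smult_add_right del: of_nat_Suc power_Suc)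
  \<comment> \<open>Since \<open>m\<close> is nonzero, the factor \<open>real m / 2\<close> of the
    derivative turns the scalar into -1/4, which then cancels the -4 from \<open>X2\<close>.\<close>
  have "smult (- 1 / 2 / real m) ((1 - X ^ 2) * pderiv (u ^ m + v ^ m)) =
      smult (- 1 / 4) (- 4 * (u * v) * (u ^ k + v ^ k))"
    unfolding X2 deriv using step.hyps by simp
  also have "\<dots> = u * v * (u ^ k + v ^ k)"
    by (simp add: numeral_poly)
  finally have "R (m + 1) = (u + v) * (u ^ m + v ^ m) - u * v * (u ^ k + v ^ k)"
    using assms(2)[OF step.hyps(1)] unfolding step.IH u_def [symmetric] v_def [symmetric]
    by (simp only: X [symmetric])
  \<comment> \<open>With \<open>m = Suc k\<close>, the cross terms
    \<open>u * v ^ m + v * u ^ m\<close> are exactly the subtracted product.\<close>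
  also have "\<dots> = u ^ (m + 1) + v ^ (m + 1)"
    by (simp add: m algebra_simps)
  finally show ?case
    by (simp add: u_def v_def)
qed

lemma even_binomial_sum_eq:
  fixes n :: nat
  assumes "n \<ge> 1"
  shows "smult (1 / 2 ^ (n - 1)) (\<Sum>k = 0..n div 2. smult (real (n choose (2 * k))) (X ^ (n - 2 * k))) =
    smult (1 / 2) (X - 1) ^ n + smult (1 / 2) (X + 1) ^ n" (is "smult _ ?S = _")
proof -
  have "(X - 1) ^ n + (X + 1) ^ n = smult 2 ?S"
    unfolding binomial_add_power_minus_power by (simp add: numeral_poly of_nat_poly)
  \<comment> \<open>The 2 is the doubling of the even terms. At \<open>n = 0\<close> truncated
    subtraction would make this false (1 against 2).\<close>
  moreover have "(1 / 2 ^ (n - 1) :: real) = (1 / 2) ^ n * 2"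
    using assms by (cases n) (auto simp: field_simps)
  ultimately show ?thesis
    by (simp only: smult_power flip: smult_smult smult_add_right)
qed

theorem proposition6:
  fixes a :: real and R :: "nat \<Rightarrow> real poly" and n :: nat
  assumes "a = - 1 / 2"
    and "R 1 = X"
    and "\<And>m. m \<ge> 1 \<Longrightarrow>
           R (m + 1) = X * R m - smult (a / real m) ((1 - X ^ 2) * pderiv (R m))"
    and "n \<ge> 1"
  shows "R n = smult (1 / 2 ^ (n - 1)) (\<Sum>k = 0..n div 2. smult (real (n choose (2 * k))) (X ^ (n - 2 * k)))
       \<and> smult (1 / 2 ^ (n - 1)) (\<Sum>k = 0..n div 2. smult (real (n choose (2 * k))) (X ^ (n - 2 * k)))
           = (smult (1 / 2) (X - 1)) ^ n + (smult (1 / 2) (X + 1)) ^ n"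
  using recurrence_power_sum[of R n] even_binomial_sum_eq[of n] assms by simp

end
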